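(* Let $\mathbb{F}$ be a field and let $(K,w)$ be a finite (or finite-type) weighted simplicial complex with weight function $w:K\to\mathbb{F}$ such that all weights of simplices are nonzero. Then, for all $n$, $H_n(K,w;\mathbb{F})\cong H_n(K;\mathbb{F})$ (as $\mathbb{F}$-vector spaces).
   Context: A weighted simplicial complex (WSC) is a pair $(K,w)$ of a simplicial complex $K$ and a function $w:K\to R$ into a commutative ring $R$ such that $w(\sigma_1)\mid w(\sigma_2)$ whenever $\sigma_1\subseteq\sigma_2$ are simplices of $K$ (automatic for nonzero weights in a field). It is of finite type if for each $n$ the number of $n$-simplices of $K$ is finite. Fix a total order on the vertices. $C_n(K,w)$ is the free module over the coefficient ring (here $R=\mathbb{F}$) on the $n$-simplices of nonzero weight. The weighted boundary map $\partial_n:C_n(K,w)\to C_{n-1}(K,w)$ is $\partial_n(\sigma)=\sum_{i=0}^n\frac{w(\sigma)}{w(d_i(\sigma))}(-1)^id_i(\sigma)$ for $\sigma=[v_0,\dots,v_n]$, where $d_i(\sigma)=[v_0,\dots,\widehat{v_i},\dots,v_n]$. The weighted homology is $H_n(K,w;\mathbb{F})=\ker\partial_n/\operatorname{Im}\partial_{n+1}$; $H_n(K;\mathbb{F})$ is the usual simplicial homology with coefficients in $\mathbb{F}$. *)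

theory Defs
  imports "HOL-Library.Poly_Mapping" "HOL-Algebra.AbelCoset" "Jordan_Normal_Form.VS_Connect"
begin

section \<open>Weighted simplicial complexes\<close>

text \<open>Simplices are finite nonempty sets of vertices; the vertices of \<open>K\<close> are the elements of
  \<open>\<Union>K\<close>. The fixed total order on the vertices is that of the type class \<^class>\<open>linorder\<close>.\<close>

definition abstract_simplicial_complex :: "'v set set \<Rightarrow> bool" where
  "abstract_simplicial_complex K \<longleftrightarrow>
     (\<forall>\<sigma>\<in>K. finite \<sigma> \<and> \<sigma> \<noteq> {}) \<and>
     (\<forall>\<sigma>\<in>K. \<forall>\<tau>. \<tau> \<subseteq> \<sigma> \<and> \<tau> \<noteq> {} \<longrightarrow> \<tau> \<in> K)"

definition weighted_simplicial_complex :: "'v set set \<Rightarrow> ('v set \<Rightarrow> 'r::comm_ring_1) \<Rightarrow> bool" where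
  "weighted_simplicial_complex K w \<longleftrightarrow>
     abstract_simplicial_complex K \<and>
     (\<forall>\<sigma>\<in>K. \<forall>\<tau>\<in>K. \<sigma> \<subseteq> \<tau> \<longrightarrow> w \<sigma> dvd w \<tau>)"

definition simplices :: "'v set set \<Rightarrow> nat \<Rightarrow> 'v set set" where
  "simplices K n = {\<sigma>\<in>K. card \<sigma> = Suc n}"

definition finite_type :: "'v set set \<Rightarrow> bool" where
  "finite_type K \<longleftrightarrow> (\<forall>n. finite (simplices K n))"

lemma finite_imp_finite_type: "finite K \<Longrightarrow> finite_type K"
  by (simp add: finite_type_def simplices_def)

text \<open>For \<open>\<sigma> = [v\<^sub>0, \<dots>, v\<^sub>n]\<close> with \<open>v\<^sub>0 < \<dots> < v\<^sub>n\<close>, \<open>face i \<sigma>\<close> omits \<open>v\<^sub>i\<close>.\<close>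

definition face :: "nat \<Rightarrow> 'v::linorder set \<Rightarrow> 'v set" where
  "face i \<sigma> = \<sigma> - {sorted_list_of_set \<sigma> ! i}"

section \<open>Free and quotient vector spaces\<close>

text \<open>The \<open>mult\<close> and \<open>one\<close> components of a \<open>module\<close> record play no role for modules.\<close>

definition free_module :: "'b set \<Rightarrow> ('f::comm_ring_1, 'b \<Rightarrow>\<^sub>0 'f) module" where
  "free_module S =
     \<lparr>carrier = {c. Poly_Mapping.keys c \<subseteq> S}, mult = undefined, one = undefined,
      zero = 0, add = (+), smult = (\<lambda>a. Poly_Mapping.map ((*) a))\<rparr>"

text \<open>The scalar multiple \<open>a (N + x) = N + a x\<close> of a coset \<open>X\<close> is formed as the union of the
  cosets of \<open>a x\<close> for \<open>x \<in> X\<close>, which all coincide when \<open>N\<close> is a submodule.\<close>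

definition quotient_module :: "('a, 'm) module \<Rightarrow> 'm set \<Rightarrow> ('a, 'm set) module" where
  "quotient_module M N =
     \<lparr>carrier = a_rcosets\<^bsub>M\<^esub> N, mult = undefined, one = undefined,
      zero = N, add = set_add M,
      smult = (\<lambda>a X. \<Union>x\<in>X. N +>\<^bsub>M\<^esub> (a \<odot>\<^bsub>M\<^esub> x))\<rparr>"

text \<open>\<^locale>\<open>linear_map\<close> includes that \<open>V\<close> and \<open>W\<close> are vector spaces over \<open>F\<close>.\<close>

definition vectorspace_isomorphic ::
    "'a ring \<Rightarrow> ('a, 'm) module \<Rightarrow> ('a, 'n) module \<Rightarrow> bool" where
  "vectorspace_isomorphic F V W \<longleftrightarrow>
     (\<exists>T. linear_map F V W T \<and> bij_betw T (carrier V) (carrier W))"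

section \<open>Simplicial and weighted homology\<close>

definition homology ::
    "(nat \<Rightarrow> ('a, 'c) module) \<Rightarrow> (nat \<Rightarrow> 'c \<Rightarrow> 'c) \<Rightarrow> nat \<Rightarrow> ('a, 'c set) module" where
  "homology C d n =
     quotient_module
       ((C n)\<lparr>carrier := {c \<in> carrier (C n). d n c = \<zero>\<^bsub>C (n - 1)\<^esub>}\<rparr>)
       (d (Suc n) ` carrier (C (Suc n)))"

text \<open>The complexes are not augmented, so the boundary maps vanish in degree \<open>0\<close>; the zero
  of \<open>C (n - 1)\<close> above is the zero chain also for \<open>n = 0\<close>.\<close>

definition simplicial_chains ::
    "'v set set \<Rightarrow> nat \<Rightarrow> ('f::field, 'v set \<Rightarrow>\<^sub>0 'f) module" where
  "simplicial_chains K n = free_module (simplices K n)"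

definition simplicial_boundary ::
    "nat \<Rightarrow> ('v::linorder set \<Rightarrow>\<^sub>0 'f::field) \<Rightarrow> ('v set \<Rightarrow>\<^sub>0 'f)" where
  "simplicial_boundary n c =
     (if n = 0 then 0
      else \<Sum>\<sigma>\<in>Poly_Mapping.keys c. \<Sum>i\<le>n.
             Poly_Mapping.single (face i \<sigma>) (Poly_Mapping.lookup c \<sigma> * (-1) ^ i))"

definition simplicial_homology ::
    "'v::linorder set set \<Rightarrow> nat \<Rightarrow> ('f::field, ('v set \<Rightarrow>\<^sub>0 'f) set) module" where
  "simplicial_homology K = homology (simplicial_chains K) simplicial_boundary"

definition weighted_chains ::
    "'v set set \<Rightarrow> ('v set \<Rightarrow> 'f) \<Rightarrow> nat \<Rightarrow> ('f::field, 'v set \<Rightarrow>\<^sub>0 'f) module" where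
  "weighted_chains K w n = free_module {\<sigma> \<in> simplices K n. w \<sigma> \<noteq> 0}"

text \<open>On simplices of nonzero weight the divisors \<open>w (face i \<sigma>)\<close> are nonzero, as they divide
  \<open>w \<sigma>\<close>.\<close>

definition weighted_boundary ::
    "('v::linorder set \<Rightarrow> 'f::field) \<Rightarrow> nat \<Rightarrow> ('v set \<Rightarrow>\<^sub>0 'f) \<Rightarrow> ('v set \<Rightarrow>\<^sub>0 'f)" where
  "weighted_boundary w n c =
     (if n = 0 then 0
      else \<Sum>\<sigma>\<in>Poly_Mapping.keys c. \<Sum>i\<le>n.
             Poly_Mapping.single (face i \<sigma>)
               (Poly_Mapping.lookup c \<sigma> * (w \<sigma> / w (face i \<sigma>) * (-1) ^ i)))"

definition weighted_homology ::
    "'v::linorder set set \<Rightarrow> ('v set \<Rightarrow> 'f) \<Rightarrow> nat \<Rightarrow> ('f::field, ('v set \<Rightarrow>\<^sub>0 'f) set) module" where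
  "weighted_homology K w = homology (weighted_chains K w) (weighted_boundary w)"

end

(* The map sending each simplex \<sigma> to w \<sigma> times \<sigma> carries the weighted boundary to the simplicial
   one: both composites send \<sigma> to the alternating sum of w \<sigma> times its faces. As all weights are
   nonzero, it is an isomorphism of chain complexes and so induces one on homology. *)

theory Submission
  imports Defs
begin

section \<open>Quotient modules\<close>

text \<open>One context for a module and its submodule; the sublocale below adds the coset calculus
  of \<open>abelian_subgroup\<close> to it.\<close>

locale module_and_submodule = M: Module.module R M + N: submodule R N M
  for R :: "('a, 'r) ring_scheme" and M :: "('a, 'm) module" and N
begin

sublocale S: abelian_subgroup N M
proof -
  have inv: "\<ominus>\<^bsub>M\<^esub> x \<in> N" if "x \<in> N" for x
  proof -
    \<comment> \<open>The closure conditions of a submodule do not mention negatives, so the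
      negative of \<open>x\<close> is reached as its multiple by -1.\<close>
    have "(\<ominus>\<^bsub>R\<^esub> \<one>\<^bsub>R\<^esub>) \<odot>\<^bsub>M\<^esub> x \<in> N"
      using that by (intro N.smult_closed) auto
    then show ?thesis
      using that N.subset by (metis M.smult_minus_1 subsetD)
  qed
  have "subgroup N (add_monoid M)"
    using N.subset inv by (intro subgroup.intro) (auto simp flip: a_inv_def)
  then show "abelian_subgroup N M"
    using abelian_subgroupI2 M.a_comm_group by blast
qed

lemma carrier_quotient_module: "carrier (quotient_module M N) = (\<lambda>x. N +>\<^bsub>M\<^esub> x) ` carrier M"
  by (auto simp: quotient_module_def A_RCOSETS_def')

lemma add_quotient_module:
  assumes "x \<in> carrier M" "y \<in> carrier M"
  shows "(N +>\<^bsub>M\<^esub> x) \<oplus>\<^bsub>quotient_module M N\<^esub> (N +>\<^bsub>M\<^esub> y) = N +>\<^bsub>M\<^esub> (x \<oplus>\<^bsub>M\<^esub> y)"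
  using S.a_rcos_sum[OF assms] by (simp add: quotient_module_def)

text \<open>If \<open>y = h + x\<close> with \<open>h\<close> in \<open>N\<close>, then
  \<open>a y = a h + a x\<close> lies in the coset of \<open>a x\<close>. So the union that defines
  the scalar multiple runs over copies of one coset.\<close>

lemma smult_quotient_module:
  assumes "a \<in> carrier R" "x \<in> carrier M"
  shows "a \<odot>\<^bsub>quotient_module M N\<^esub> (N +>\<^bsub>M\<^esub> x) = N +>\<^bsub>M\<^esub> (a \<odot>\<^bsub>M\<^esub> x)"
proof -
  have "N +>\<^bsub>M\<^esub> (a \<odot>\<^bsub>M\<^esub> y) = N +>\<^bsub>M\<^esub> (a \<odot>\<^bsub>M\<^esub> x)" if y: "y \<in> N +>\<^bsub>M\<^esub> x" for y
  proof -
    obtain h where h: "h \<in> N" "y = h \<oplus>\<^bsub>M\<^esub> x"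
      using y by (auto simp: a_r_coset_def')
    have "a \<odot>\<^bsub>M\<^esub> y \<in> N +>\<^bsub>M\<^esub> (a \<odot>\<^bsub>M\<^esub> x)"
      using h assms N.subset by (auto simp: a_r_coset_def' M.smult_r_distr subset_iff)
    then show ?thesis
      using S.a_repr_independence' assms by simp
  qed
  \<comment> \<open>The union of a constant family equals its value only over a nonempty index
    set.\<close>
  moreover have "x \<in> N +>\<^bsub>M\<^esub> x"
    using S.a_rcos_self assms by blast
  ultimately have "(\<Union>y\<in>N +>\<^bsub>M\<^esub> x. N +>\<^bsub>M\<^esub> (a \<odot>\<^bsub>M\<^esub> y)) = N +>\<^bsub>M\<^esub> (a \<odot>\<^bsub>M\<^esub> x)"
    by (intro UN_constant_eq) blast+
  then show ?thesis
    by (simp add: quotient_module_def)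
qed

lemma module_quotient_module: "Module.module R (quotient_module M N)"
proof (rule moduleI)
  let ?Q = "quotient_module M N"
  \<comment> \<open>With \<open>N\<close> rewritten as the coset of zero, every module axiom reduces
    to the same axiom for representatives in \<open>M\<close>.\<close>
  have zero: "\<zero>\<^bsub>?Q\<^esub> = N +>\<^bsub>M\<^esub> \<zero>\<^bsub>M\<^esub>"
    using M.a_coset_add_zero[OF N.subset] by (simp add: quotient_module_def)
  have neg: "\<exists>y\<in>carrier M. N +>\<^bsub>M\<^esub> (x \<oplus>\<^bsub>M\<^esub> y) = N +>\<^bsub>M\<^esub> \<zero>\<^bsub>M\<^esub>" if "x \<in> carrier M" for x
    using that by (intro bexI[of _ "\<ominus>\<^bsub>M\<^esub> x"]) (simp_all add: M.r_neg)
  show "abelian_group ?Q"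
    by (rule abelian_groupI)
      (auto simp: carrier_quotient_module add_quotient_module zero neg M.a_ac)
qed (auto simp: carrier_quotient_module add_quotient_module smult_quotient_module
      M.smult_l_distr M.smult_r_distr M.smult_assoc1 intro: M.R.is_cring)

end

section \<open>Linear maps and the isomorphisms they induce on quotients\<close>

lemma linear_mapI:
  assumes "vectorspace F V" "vectorspace F W"
    and "\<And>x. x \<in> carrier V \<Longrightarrow> T x \<in> carrier W"
    and "\<And>x y. x \<in> carrier V \<Longrightarrow> y \<in> carrier V \<Longrightarrow> T (x \<oplus>\<^bsub>V\<^esub> y) = T x \<oplus>\<^bsub>W\<^esub> T y"
    and "\<And>a x. a \<in> carrier F \<Longrightarrow> x \<in> carrier V \<Longrightarrow> T (a \<odot>\<^bsub>V\<^esub> x) = a \<odot>\<^bsub>W\<^esub> T x"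
  shows "linear_map F V W T"
  using assms
  by (auto simp: linear_map_def mod_hom_def mod_hom_axioms_def LinearCombinations.module_hom_def
      vectorspace_def)

lemma (in mod_hom) submodule_image:
  assumes "submodule R H M"
  shows "submodule R (f ` H) N"
proof -
  interpret H: submodule R H M by fact
  show ?thesis
  proof
    show "f ` H \<subseteq> carrier N"
      using H.subset by auto
    show "\<zero>\<^bsub>N\<^esub> \<in> f ` H"
      using f0_is_0 H.zero_closed by (metis image_eqI)
  next
    fix v w assume "v \<in> f ` H" "w \<in> f ` H"
    then obtain x y where xy: "x \<in> H" "y \<in> H" "v = f x" "w = f y"
      by blast
    have "v \<oplus>\<^bsub>N\<^esub> w = f (x \<oplus>\<^bsub>M\<^esub> y)"
      using f_add[OF subsetD[OF H.subset xy(1)] subsetD[OF H.subset xy(2)]] xy(3,4) by (simp only:)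
    then show "v \<oplus>\<^bsub>N\<^esub> w \<in> f ` H"
      using H.m_closed[OF xy(1,2)] by blast
  next
    fix c v assume c: "c \<in> carrier R" and "v \<in> f ` H"
    then obtain x where x: "x \<in> H" "v = f x"
      by blast
    have "c \<odot>\<^bsub>N\<^esub> v = f (c \<odot>\<^bsub>M\<^esub> x)"
      using f_smult[OF c subsetD[OF H.subset x(1)]] x(2) by (simp only:)
    then show "c \<odot>\<^bsub>N\<^esub> v \<in> f ` H"
      using H.smult_closed[OF c x(1)] by blast
  qed
qed

text \<open>\<open>T\<close> maps the coset of \<open>x\<close> onto the coset of
  \<open>T x\<close>, so taking images under \<open>T\<close> is itself the induced map, and no
  representatives have to be chosen.\<close>

lemma vectorspace_isomorphic_quotient_module:
  assumes T: "linear_map F V W T" and bij: "bij_betw T (carrier V) (carrier W)"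
    and N: "submodule F N V"
  shows "vectorspace_isomorphic F (quotient_module V N) (quotient_module W (T ` N))"
proof -
  interpret T: linear_map F V W T by fact
  interpret N: submodule F N V by fact
  interpret VN: module_and_submodule F V N ..
  have TN: "submodule F (T ` N) W"
    by (rule T.submodule_image) fact
  then interpret TN: submodule F "T ` N" W .
  interpret WN: module_and_submodule F W "T ` N" ..
  have img: "T ` (N +>\<^bsub>V\<^esub> x) = T ` N +>\<^bsub>W\<^esub> T x" if x: "x \<in> carrier V" for x
  proof -
    have "T (h \<oplus>\<^bsub>V\<^esub> x) = T h \<oplus>\<^bsub>W\<^esub> T x" if "h \<in> N" for h
      using that x N.subset by auto
    then show ?thesis
      by (simp add: a_r_coset_def' image_UN)
  qed
  have Q: "vectorspace F (quotient_module V N)" "vectorspace F (quotient_module W (T ` N))"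
    using VN.module_quotient_module WN.module_quotient_module linear_map.axioms(1)[OF T]
    by (simp_all add: vectorspace_def)
  have "linear_map F (quotient_module V N) (quotient_module W (T ` N)) ((`) T)"
  proof (rule linear_mapI[OF Q])
    fix X assume "X \<in> carrier (quotient_module V N)"
    then show "T ` X \<in> carrier (quotient_module W (T ` N))"
      by (auto simp only: VN.carrier_quotient_module WN.carrier_quotient_module img intro!: imageI T.f_im)
  next
    fix X Y assume "X \<in> carrier (quotient_module V N)" "Y \<in> carrier (quotient_module V N)"
    then obtain x y where xy: "x \<in> carrier V" "y \<in> carrier V" "X = N +>\<^bsub>V\<^esub> x" "Y = N +>\<^bsub>V\<^esub> y"
      by (auto simp: VN.carrier_quotient_module)
    then have "x \<oplus>\<^bsub>V\<^esub> y \<in> carrier V" "T x \<in> carrier W" "T y \<in> carrier W"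
      by auto
    with xy show "T ` (X \<oplus>\<^bsub>quotient_module V N\<^esub> Y) = T ` X \<oplus>\<^bsub>quotient_module W (T ` N)\<^esub> T ` Y"
      by (simp only: VN.add_quotient_module WN.add_quotient_module img T.f_add)
  next
    fix a X assume a: "a \<in> carrier F" and "X \<in> carrier (quotient_module V N)"
    then obtain x where x: "x \<in> carrier V" "X = N +>\<^bsub>V\<^esub> x"
      by (auto simp: VN.carrier_quotient_module)
    with a have "a \<odot>\<^bsub>V\<^esub> x \<in> carrier V" "T x \<in> carrier W"
      by auto
    with a x show "T ` (a \<odot>\<^bsub>quotient_module V N\<^esub> X) = a \<odot>\<^bsub>quotient_module W (T ` N)\<^esub> T ` X"
      by (simp only: VN.smult_quotient_module WN.smult_quotient_module img T.f_smult)
  qed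
  moreover have "bij_betw ((`) T) (carrier (quotient_module V N)) (carrier (quotient_module W (T ` N)))"
  proof (rule bij_betw_imageI)
    \<comment> \<open>\<open>T\<close> is injective only on \<open>carrier V\<close>; cosets lie
      inside it, so distinct cosets have distinct images.\<close>
    have "N +>\<^bsub>V\<^esub> x \<subseteq> carrier V" if "x \<in> carrier V" for x
      using that N.subset by (auto simp: a_r_coset_def')
    then show "inj_on ((`) T) (carrier (quotient_module V N))"
      using inj_on_image_eq_iff[OF bij_betw_imp_inj_on[OF bij]]
      by (intro inj_onI) (auto simp: VN.carrier_quotient_module)
    have "carrier W = T ` carrier V"
      using bij by (simp add: bij_betw_def)
    then show "(`) T ` carrier (quotient_module V N) = carrier (quotient_module W (T ` N))"
      by (simp add: VN.carrier_quotient_module WN.carrier_quotient_module image_image img)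
  qed
  ultimately show ?thesis
    unfolding vectorspace_isomorphic_def by blast
qed

section \<open>Isomorphic chain complexes\<close>

text \<open>An isomorphism of chain complexes matches cycles with cycles and boundaries with
  boundaries, which reduces the claim to quotients. For \<open>k = 0\<close> truncated subtraction
  makes \<open>d 0\<close> an endomorphism of \<open>C 0\<close>.\<close>

lemma vectorspace_isomorphic_homology:
  assumes d: "\<And>k. linear_map F (C k) (C (k - 1)) (d k)"
    and dd: "\<And>k c. c \<in> carrier (C (Suc k)) \<Longrightarrow> d k (d (Suc k) c) = \<zero>\<^bsub>C (k - 1)\<^esub>"
    and f: "\<And>k. linear_map F (C k) (D k) (f k)"
    and bij: "\<And>k. bij_betw (f k) (carrier (C k)) (carrier (D k))"
    and comm: "\<And>k c. c \<in> carrier (C k) \<Longrightarrow> e k (f k c) = f (k - 1) (d k c)"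
  shows "vectorspace_isomorphic F (homology C d n) (homology D e n)"
proof -
  let ?Z = "(C n)\<lparr>carrier := {c \<in> carrier (C n). d n c = \<zero>\<^bsub>C (n - 1)\<^esub>}\<rparr>"
  let ?Z' = "(D n)\<lparr>carrier := {c \<in> carrier (D n). e n c = \<zero>\<^bsub>D (n - 1)\<^esub>}\<rparr>"
  let ?B = "d (Suc n) ` carrier (C (Suc n))"
  interpret dn: linear_map F "C n" "C (n - 1)" "d n" by (rule d)
  interpret dS: linear_map F "C (Suc n)" "C n" "d (Suc n)" using d[of "Suc n"] by simp
  interpret fn: linear_map F "C n" "D n" "f n" by (rule f)
  interpret fp: linear_map F "C (n - 1)" "D (n - 1)" "f (n - 1)" by (rule f)
  have img: "f k ` carrier (C k) = carrier (D k)" for k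
    using bij by (simp add: bij_betw_def)
  have zero: "\<zero>\<^bsub>C (n - 1)\<^esub> \<in> carrier (C (n - 1))"
    by (simp del: One_nat_def)
  \<comment> \<open>An injective linear map kills only zero; by \<open>comm\<close>,
    \<open>c\<close> is then a cycle exactly when \<open>f n c\<close> is one.\<close>
  have "f (n - 1) x = \<zero>\<^bsub>D (n - 1)\<^esub> \<longleftrightarrow> x = \<zero>\<^bsub>C (n - 1)\<^esub>" if "x \<in> carrier (C (n - 1))" for x
    using that bij_betw_imp_inj_on[OF bij] fp.f0_is_0 zero by (metis inj_onD)
  then have cycle: "e n (f n c) = \<zero>\<^bsub>D (n - 1)\<^esub> \<longleftrightarrow> d n c = \<zero>\<^bsub>C (n - 1)\<^esub>" if "c \<in> carrier (C n)" for c
    using that by (simp add: comm del: One_nat_def)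
  have fZ: "f n ` carrier ?Z = carrier ?Z'"
    using img[of n, symmetric] cycle by auto
  have kerZ: "submodule F (carrier ?Z) (C n)"
    using dn.ker_is_submodule by (simp add: dn.ker_def del: One_nat_def)
  \<comment> \<open>\<open>e\<close> is accessible only through \<open>comm\<close>, so its cycles
    form a submodule as the image under \<open>f n\<close> of the cycles of
    \<open>d\<close>.\<close>
  have kerZ': "submodule F (carrier ?Z') (D n)"
    unfolding fZ[symmetric] by (rule fn.submodule_image) (fact kerZ)
  have Z: "vectorspace F ?Z" "vectorspace F ?Z'"
    using linear_map.axioms(1,2)[OF f[of n]] kerZ kerZ'
    by (simp_all add: vectorspace.subspace_is_vs subspace.intro)
  have "linear_map F ?Z ?Z' (f n)"
    using Z by (rule linear_mapI) (auto simp: cycle simp del: One_nat_def)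
  moreover have "bij_betw (f n) (carrier ?Z) (carrier ?Z')"
    using inj_on_subset[OF bij_betw_imp_inj_on[OF bij]] fZ by (intro bij_betw_imageI) auto
  \<comment> \<open>The boundaries form a submodule of \<open>C n\<close>; \<open>dd\<close> places
    them inside the cycles.\<close>
  moreover have "submodule F ?B ?Z"
  proof -
    interpret B: submodule F ?B "C n"
      using dS.im_is_submodule by (simp add: dS.im_def)
    show ?thesis
      using Z(1) dd B.m_closed B.zero_closed B.smult_closed
      by (intro submodule.intro) (auto simp: vectorspace_def)
  qed
  \<comment> \<open>Every chain of \<open>D (Suc n)\<close> is the image of one of
    \<open>C (Suc n)\<close>, so \<open>comm\<close> in degree \<open>Suc n\<close> matches the
    boundaries.\<close>
  moreover have "f n ` ?B = e (Suc n) ` carrier (D (Suc n))"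
    using comm[of _ "Suc n"] by (force simp: img[symmetric] image_image intro!: image_cong)
  ultimately show ?thesis
    unfolding homology_def using vectorspace_isomorphic_quotient_module[of F ?Z ?Z' "f n" ?B] by simp
qed

section \<open>Linear extension of maps on simplices\<close>

text \<open>\<open>Poly_Mapping.map\<close> keeps zero coefficients at zero, which agrees with
  multiplication because \<open>a * 0 = 0\<close>.\<close>

lemma lookup_map_mult:
  "Poly_Mapping.lookup (Poly_Mapping.map ((*) (a::'f::comm_ring_1)) x) k = a * Poly_Mapping.lookup x k"
  by (simp add: Poly_Mapping.map.rep_eq when_def)

lemma map_mult_zero: "Poly_Mapping.map ((*) (a::'f::comm_ring_1)) 0 = 0"
  by (rule poly_mapping_eqI) (simp add: lookup_map_mult)

lemma keys_map_mult_subset: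
  "Poly_Mapping.keys (Poly_Mapping.map ((*) (a::'f::comm_ring_1)) x) \<subseteq> Poly_Mapping.keys x"
  by (auto simp: in_keys_iff lookup_map_mult)

lemma vectorspace_free_module: "vectorspace class_ring (free_module S :: ('f::field, 'b \<Rightarrow>\<^sub>0 'f) module)"
proof -
  have "abelian_group (free_module S :: ('f, 'b \<Rightarrow>\<^sub>0 'f) module)"
  proof (rule abelian_groupI)
    fix x assume "x \<in> carrier (free_module S :: ('f, 'b \<Rightarrow>\<^sub>0 'f) module)"
    then show "\<exists>y\<in>carrier (free_module S :: ('f, 'b \<Rightarrow>\<^sub>0 'f) module). y \<oplus>\<^bsub>free_module S\<^esub> x = \<zero>\<^bsub>free_module S\<^esub>"
      by (intro bexI[of _ "- x"]) (auto simp: free_module_def)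
  qed (use keys_add in \<open>fastforce simp: free_module_def add_ac\<close>)+
  then have "Module.module class_ring (free_module S :: ('f, 'b \<Rightarrow>\<^sub>0 'f) module)"
    by (rule moduleI[OF class_cring.is_cring])
      (use keys_map_mult_subset in
        \<open>fastforce simp: free_module_def lookup_map_mult lookup_add algebra_simps intro!: poly_mapping_eqI\<close>)+
  then show ?thesis
    by (simp add: vectorspace_def class_field)
qed

text \<open>Boundary maps and the rescaling of simplices all have this form, so linearity and
  composition are settled once for all of them.\<close>

definition linear_extension ::
    "('b \<Rightarrow> 'c \<Rightarrow>\<^sub>0 'f) \<Rightarrow> ('b \<Rightarrow>\<^sub>0 'f::comm_ring_1) \<Rightarrow> ('c \<Rightarrow>\<^sub>0 'f)" where
  "linear_extension g c =
     (\<Sum>\<sigma>\<in>Poly_Mapping.keys c. Poly_Mapping.map ((*) (Poly_Mapping.lookup c \<sigma>)) (g \<sigma>))"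

text \<open>Terms outside the support vanish. Enlarging the index set lets chains with different
  supports be compared over a common one.\<close>

lemma lookup_linear_extension:
  assumes "finite A" "Poly_Mapping.keys c \<subseteq> A"
  shows "Poly_Mapping.lookup (linear_extension g c) \<tau> =
    (\<Sum>\<sigma>\<in>A. Poly_Mapping.lookup c \<sigma> * Poly_Mapping.lookup (g \<sigma>) \<tau>)"
  unfolding linear_extension_def lookup_sum lookup_map_mult using assms
  by (intro sum.mono_neutral_left) (auto simp: in_keys_iff)

lemma linear_extension_add: "linear_extension g (c + d) = linear_extension g c + linear_extension g d"
proof (rule poly_mapping_eqI)
  fix \<tau>
  let ?A = "Poly_Mapping.keys c \<union> Poly_Mapping.keys d"
  show "Poly_Mapping.lookup (linear_extension g (c + d)) \<tau> =
      Poly_Mapping.lookup (linear_extension g c + linear_extension g d) \<tau>"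
    by (simp add: lookup_linear_extension[of ?A] keys_add lookup_add distrib_right sum.distrib)
qed

lemma linear_extension_smult:
  "linear_extension g (Poly_Mapping.map ((*) a) c) = Poly_Mapping.map ((*) a) (linear_extension g c)"
proof (rule poly_mapping_eqI)
  fix \<tau>
  show "Poly_Mapping.lookup (linear_extension g (Poly_Mapping.map ((*) a) c)) \<tau> =
      Poly_Mapping.lookup (Poly_Mapping.map ((*) a) (linear_extension g c)) \<tau>"
    by (simp add: lookup_linear_extension[of "Poly_Mapping.keys c"] keys_map_mult_subset
        lookup_map_mult sum_distrib_left mult.assoc)
qed

lemma linear_extension_zero [simp]: "linear_extension g 0 = 0"
  by (simp add: linear_extension_def)

lemma linear_extension_sum: "linear_extension g (sum h A) = (\<Sum>x\<in>A. linear_extension g (h x))"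
  by (induction A rule: infinite_finite_induct) (simp_all add: linear_extension_add)

lemma linear_extension_single:
  "linear_extension g (Poly_Mapping.single \<sigma> a) = Poly_Mapping.map ((*) a) (g \<sigma>)"
  by (auto simp: linear_extension_def intro!: poly_mapping_eqI simp: lookup_map_mult)

text \<open>Together with \<open>linear_extension_cong\<close> this reduces identities between
  composites of chain maps to single simplices.\<close>

lemma linear_extension_linear_extension:
  "linear_extension g (linear_extension h c) = linear_extension (\<lambda>\<sigma>. linear_extension g (h \<sigma>)) c"
  by (simp add: linear_extension_def[of h] linear_extension_def[of "\<lambda>\<sigma>. linear_extension g (h \<sigma>)"]
      linear_extension_sum linear_extension_smult)

lemma linear_extension_cong:
  assumes "\<And>\<sigma>. \<sigma> \<in> Poly_Mapping.keys c \<Longrightarrow> g \<sigma> = h \<sigma>"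
  shows "linear_extension g c = linear_extension h c"
  using assms by (simp add: linear_extension_def)

lemma linear_extension_single_one: "linear_extension (\<lambda>\<sigma>. Poly_Mapping.single \<sigma> 1) c = c"
proof (rule poly_mapping_eqI)
  fix \<tau>
  show "Poly_Mapping.lookup (linear_extension (\<lambda>\<sigma>. Poly_Mapping.single \<sigma> 1) c) \<tau> = Poly_Mapping.lookup c \<tau>"
    \<comment> \<open>With \<tau> in the index set the sum collapses to its term at \<tau>, whether
      or not \<tau> is a key of \<open>c\<close>.\<close>
    by (simp add: lookup_linear_extension[of "insert \<tau> (Poly_Mapping.keys c)"] lookup_single when_def
        subset_insertI if_distrib cong: if_cong)
qed

lemma linear_map_linear_extension:
  fixes g :: "'b \<Rightarrow> 'c \<Rightarrow>\<^sub>0 'f::field"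
  assumes "\<And>\<sigma>. \<sigma> \<in> S \<Longrightarrow> Poly_Mapping.keys (g \<sigma>) \<subseteq> S'"
  shows "linear_map class_ring (free_module S) (free_module S') (linear_extension g)"
proof (rule linear_mapI)
  fix c :: "'b \<Rightarrow>\<^sub>0 'f" assume "c \<in> carrier (free_module S)"
  then have "Poly_Mapping.keys c \<subseteq> S"
    by (simp add: free_module_def)
  then have "Poly_Mapping.keys (linear_extension g c) \<subseteq> S'"
    unfolding linear_extension_def
    by (intro order.trans[OF keys_sum] UN_least order.trans[OF keys_map_mult_subset] assms) auto
  then show "linear_extension g c \<in> carrier (free_module S')"
    by (simp add: free_module_def)
qed (rule vectorspace_free_module | simp add: free_module_def linear_extension_add linear_extension_smult)+

section \<open>The weighted boundary map\<close>

lemma sorted_list_of_set_face: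
  assumes "finite \<sigma>" "i < card \<sigma>"
  shows "sorted_list_of_set (face i \<sigma>) =
    take i (sorted_list_of_set \<sigma>) @ drop (Suc i) (sorted_list_of_set \<sigma>)"
proof -
  let ?xs = "sorted_list_of_set \<sigma>"
  have len: "i < length ?xs"
    using assms by simp
  have split: "?xs = take i ?xs @ ?xs ! i # drop (Suc i) ?xs"
    using len by (rule id_take_nth_drop)
  moreover have "distinct ?xs"
    by simp
  \<comment> \<open>As the vertex does not occur earlier, \<open>remove1\<close> deletes precisely
    position \<open>i\<close>.\<close>
  ultimately have "?xs ! i \<notin> set (take i ?xs)"
    by (metis distinct_append disjoint_iff list.set_intros(1))
  then have "remove1 (?xs ! i) ?xs = take i ?xs @ drop (Suc i) ?xs"
    by (subst (2) split) (simp add: remove1_append)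
  then show ?thesis
    using assms by (simp add: face_def sorted_list_of_set_remove)
qed

text \<open>Both sides omit the vertices at positions \<open>i\<close> and \<open>j + 1\<close>:
  deleting position \<open>i\<close> moves the later vertex down to position \<open>j\<close>, while
  deleting position \<open>j + 1\<close> leaves position \<open>i\<close> in place.\<close>

lemma face_face:
  assumes "finite \<sigma>" "i \<le> j" "Suc j < card \<sigma>"
  shows "face j (face i \<sigma>) = face i (face (Suc j) \<sigma>)"
proof -
  have "face j (face i \<sigma>) = \<sigma> - {sorted_list_of_set \<sigma> ! i} - {sorted_list_of_set \<sigma> ! Suc j}"
    unfolding face_def[of j] using assms
    by (simp add: sorted_list_of_set_face nth_append) (simp add: face_def)
  moreover have "face i (face (Suc j) \<sigma>) = \<sigma> - {sorted_list_of_set \<sigma> ! Suc j} - {sorted_list_of_set \<sigma> ! i}"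
    unfolding face_def[of i] using assms
    by (simp add: sorted_list_of_set_face nth_append) (simp add: face_def)
  ultimately show ?thesis
    by auto
qed

lemma face_in_simplices:
  assumes K: "abstract_simplicial_complex K" and \<sigma>: "\<sigma> \<in> simplices K (Suc n)" and i: "i \<le> Suc n"
  shows "face i \<sigma> \<in> simplices K n"
proof -
  have fin: "finite \<sigma>" and card: "card \<sigma> = Suc (Suc n)" and "\<sigma> \<in> K"
    using K \<sigma> by (auto simp: abstract_simplicial_complex_def simplices_def)
  have "sorted_list_of_set \<sigma> ! i \<in> set (sorted_list_of_set \<sigma>)"
    using card i by (intro nth_mem) simp
  then have "card (face i \<sigma>) = Suc n"
    using fin card by (simp add: face_def)
  \<comment> \<open>Starting in degree \<open>Suc n\<close> keeps the face nonempty, as downward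
    closure of \<open>K\<close> demands.\<close>
  moreover from this have "face i \<sigma> \<noteq> {}"
    by auto
  moreover have "face i \<sigma> \<subseteq> \<sigma>"
    by (auto simp: face_def)
  ultimately have "face i \<sigma> \<in> K"
    using K \<open>\<sigma> \<in> K\<close> unfolding abstract_simplicial_complex_def by blast
  with \<open>card (face i \<sigma>) = Suc n\<close> show ?thesis
    by (simp add: simplices_def)
qed

text \<open>The index pairs split into those with \<open>i \<le> j\<close> and those with
  \<open>j < i\<close>. The bijection sending \<open>(i, j)\<close> to \<open>(j + 1, i)\<close>
  pairs the two halves with opposite signs.\<close>

lemma alternating_double_sum_eq_0:
  fixes F :: "nat \<Rightarrow> nat \<Rightarrow> 'a::ab_group_add"
  assumes "\<And>i j. i \<le> j \<Longrightarrow> j \<le> n \<Longrightarrow> F (Suc j) i = - F i j"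
  shows "(\<Sum>i\<le>Suc n. \<Sum>j\<le>n. F i j) = 0"
proof -
  let ?U = "{(i, j). i \<le> j \<and> j \<le> n}" and ?L = "{(i, j). j < i \<and> i \<le> Suc n}"
  have fin: "finite ?U" "finite ?L"
    by (rule finite_subset[of _ "{..Suc n} \<times> {..Suc n}"]; force)+
  have "(\<Sum>(i, j)\<in>?L. F i j) = (\<Sum>(i, j)\<in>?U. F (Suc j) i)"
    by (rule sum.reindex_bij_witness[of _ "\<lambda>(i, j). (Suc j, i)" "\<lambda>(i, j). (j, i - 1)"]) auto
  also have "\<dots> = - (\<Sum>(i, j)\<in>?U. F i j)"
    using assms by (subst sum_negf[symmetric], intro sum.cong) auto
  finally have "(\<Sum>(i, j)\<in>?U \<union> ?L. F i j) = 0"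
    using fin by (subst sum.union_disjoint) auto
  moreover have "?U \<union> ?L = {..Suc n} \<times> {..n}"
    by auto
  ultimately show ?thesis
    by (simp add: sum.cartesian_product)
qed

section \<open>Boundaries of single simplices\<close>

definition simplex_boundary ::
    "('v::linorder set \<Rightarrow> 'f::field) \<Rightarrow> nat \<Rightarrow> 'v set \<Rightarrow> ('v set \<Rightarrow>\<^sub>0 'f)" where
  "simplex_boundary w n \<sigma> =
     (if n = 0 then 0
      else \<Sum>i\<le>n. Poly_Mapping.single (face i \<sigma>) (w \<sigma> / w (face i \<sigma>) * (-1) ^ i))"

lemma map_mult_sum:
  "Poly_Mapping.map ((*) (a::'f::comm_ring_1)) (sum h A) = (\<Sum>x\<in>A. Poly_Mapping.map ((*) a) (h x))"
  by (rule poly_mapping_eqI) (simp add: lookup_map_mult lookup_sum sum_distrib_left)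

lemma map_mult_single:
  "Poly_Mapping.map ((*) (a::'f::comm_ring_1)) (Poly_Mapping.single k b) = Poly_Mapping.single k (a * b)"
  by (rule poly_mapping_eqI) (simp add: lookup_map_mult lookup_single when_def)

lemma weighted_boundary_eq: "weighted_boundary w n = linear_extension (simplex_boundary w n)"
  by (rule ext) (simp add: weighted_boundary_def linear_extension_def simplex_boundary_def
      map_mult_zero map_mult_sum map_mult_single)

text \<open>Constant weight 1 turns every weight quotient into 1.\<close>

lemma simplicial_boundary_eq: "simplicial_boundary = weighted_boundary (\<lambda>_. 1)"
  by (intro ext) (simp add: simplicial_boundary_def weighted_boundary_def)

text \<open>In degree 0 the boundary is zero and has no keys, so the truncation of
  \<open>n - 1\<close> does no harm.\<close>

lemma keys_simplex_boundary:
  assumes "abstract_simplicial_complex K" "\<sigma> \<in> simplices K n"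
  shows "Poly_Mapping.keys (simplex_boundary w n \<sigma>) \<subseteq> simplices K (n - 1)"
proof (cases n)
  case (Suc m)
  show ?thesis
    using assms face_in_simplices[of K \<sigma> m] unfolding simplex_boundary_def Suc
    by (auto intro!: order.trans[OF keys_sum] split: if_splits simp del: sum.atMost_Suc)
qed (simp add: simplex_boundary_def)

text \<open>The weight quotients telescope to \<open>w \<sigma>\<close> over the weight of the
  twofold face. This depends only on that face, so the usual sign cancellation by
  \<open>face_face\<close> goes through.\<close>

lemma weighted_boundary_simplex_boundary:
  assumes K: "abstract_simplicial_complex K" and w: "\<And>\<sigma>. \<sigma> \<in> K \<Longrightarrow> w \<sigma> \<noteq> 0"
    and \<sigma>: "\<sigma> \<in> simplices K (Suc n)"
  shows "weighted_boundary w n (simplex_boundary w (Suc n) \<sigma>) = 0"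
proof (cases n)
  case (Suc m)
  let ?ff = "\<lambda>i j. face j (face i \<sigma>)"
  let ?F = "\<lambda>i j. Poly_Mapping.single (?ff i j) (w \<sigma> / w (?ff i j) * (-1) ^ (i + j))"
  have fin: "finite \<sigma>" and card: "card \<sigma> = Suc (Suc n)"
    using K \<sigma> by (auto simp: abstract_simplicial_complex_def simplices_def)
  \<comment> \<open>This intermediate weight appears once as numerator and once as denominator;
    being nonzero, it cancels.\<close>
  have "w (face i \<sigma>) \<noteq> 0" if "i \<le> Suc n" for i
    using face_in_simplices[OF K \<sigma> that] w by (auto simp: simplices_def)
  then have "weighted_boundary w n (simplex_boundary w (Suc n) \<sigma>) = (\<Sum>i\<le>Suc n. \<Sum>j\<le>n. ?F i j)"
    unfolding weighted_boundary_eq simplex_boundary_def[of w "Suc n"]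
    by (simp add: linear_extension_sum linear_extension_single del: sum.atMost_Suc,
        intro sum.cong refl)
      (simp add: simplex_boundary_def Suc map_mult_sum map_mult_single power_add mult_ac del: sum.atMost_Suc)
  also have "\<dots> = 0"
    using face_face[OF fin] card
    by (intro alternating_double_sum_eq_0) (simp add: single_uminus add.commute)
  finally show ?thesis .
qed (simp add: weighted_boundary_def)

theorem theorem5p3:
  fixes K :: "'v::linorder set set"
    and w :: "'v set \<Rightarrow> 'f::field"
    and n :: nat
  assumes "weighted_simplicial_complex K w"
    and "finite_type K"
    and "\<And>\<sigma>. \<sigma> \<in> K \<Longrightarrow> w \<sigma> \<noteq> 0"
  shows "vectorspace_isomorphic class_ring (weighted_homology K w n) (simplicial_homology K n)"
proof -
  \<comment> \<open>The diagonal map multiplying each simplex \<sigma> by \<open>u \<sigma>\<close>;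
    \<open>u = w\<close> gives the chain isomorphism.\<close>
  let ?scale = "\<lambda>u :: 'v set \<Rightarrow> 'f. linear_extension (\<lambda>\<sigma>. Poly_Mapping.single \<sigma> (u \<sigma>))"
  have K: "abstract_simplicial_complex K"
    using assms(1) by (simp add: weighted_simplicial_complex_def)
  have w: "w \<sigma> \<noteq> 0" if "\<sigma> \<in> simplices K k" for \<sigma> k
    using that assms(3) by (simp add: simplices_def)
  \<comment> \<open>No simplex has weight zero, so none is discarded and both complexes have the
    same chain spaces.\<close>
  have chains: "weighted_chains K w = simplicial_chains K"
    using w by (auto simp: weighted_chains_def simplicial_chains_def fun_eq_iff intro!: arg_cong[of _ _ free_module])
  have keys: "Poly_Mapping.keys c \<subseteq> simplices K k" if "c \<in> carrier (simplicial_chains K k)"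
    for c :: "'v set \<Rightarrow>\<^sub>0 'f" and k
    using that by (simp add: simplicial_chains_def free_module_def)
  have scale_lin: "linear_map class_ring (simplicial_chains K k) (simplicial_chains K k) (?scale u)" for u k
    unfolding simplicial_chains_def by (rule linear_map_linear_extension) auto
  \<comment> \<open>Successive scalings multiply their factors simplex by simplex. This is used for
    \<open>w\<close> and its pointwise inverse, in both orders.\<close>
  have inv: "?scale u (?scale v c) = c"
    if "c \<in> carrier (simplicial_chains K k)" "\<And>\<sigma>. \<sigma> \<in> simplices K k \<Longrightarrow> u \<sigma> * v \<sigma> = 1" for u v c k
  proof -
    have "?scale u (?scale v c) = linear_extension (\<lambda>\<sigma>. Poly_Mapping.single \<sigma> 1) c"
      using keys[OF that(1)] that(2) unfolding linear_extension_linear_extension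
      by (intro linear_extension_cong)
        (auto simp: linear_extension_single map_mult_single mult.commute)
    then show ?thesis
      by (simp add: linear_extension_single_one)
  qed
  show ?thesis
    unfolding weighted_homology_def simplicial_homology_def chains
  proof (rule vectorspace_isomorphic_homology[where f = "\<lambda>_. ?scale w"])
    fix k
    show "linear_map class_ring (simplicial_chains K k) (simplicial_chains K (k - 1)) (weighted_boundary w k)"
      unfolding simplicial_chains_def weighted_boundary_eq
      by (intro linear_map_linear_extension keys_simplex_boundary K)
    show "linear_map class_ring (simplicial_chains K k) (simplicial_chains K k) (?scale w)"
      by (rule scale_lin)
    have maps: "?scale u ` carrier (simplicial_chains K k) \<subseteq> carrier (simplicial_chains K k)" for u
      using linear_map.axioms(3)[OF scale_lin] by (auto intro: mod_hom.f_im)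
    show "bij_betw (?scale w) (carrier (simplicial_chains K k)) (carrier (simplicial_chains K k))"
      by (rule bij_betw_byWitness[where f' = "?scale (\<lambda>\<sigma>. inverse (w \<sigma>))"])
        (use maps w in \<open>auto intro!: inv\<close>)
  next
    fix k and c :: "'v set \<Rightarrow>\<^sub>0 'f"
    assume "c \<in> carrier (simplicial_chains K (Suc k))"
    then have c: "Poly_Mapping.keys c \<subseteq> simplices K (Suc k)"
      by (rule keys)
    \<comment> \<open>The composite is a linear extension whose values on the simplices of
      \<open>c\<close> are all zero.\<close>
    have "weighted_boundary w k (weighted_boundary w (Suc k) c) = linear_extension (\<lambda>_. 0) c"
      using c weighted_boundary_simplex_boundary[OF K assms(3)]
      unfolding weighted_boundary_eq linear_extension_linear_extension
      by (intro linear_extension_cong) auto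
    also have "\<dots> = 0"
      by (rule poly_mapping_eqI) (simp add: linear_extension_def lookup_sum lookup_map_mult)
    finally show "weighted_boundary w k (weighted_boundary w (Suc k) c) = \<zero>\<^bsub>simplicial_chains K (k - 1)\<^esub>"
      by (simp add: simplicial_chains_def free_module_def)
  next
    fix k and c :: "'v set \<Rightarrow>\<^sub>0 'f"
    assume "c \<in> carrier (simplicial_chains K k)"
    then have c: "Poly_Mapping.keys c \<subseteq> simplices K k"
      by (rule keys)
    \<comment> \<open>In positive degree both sides are the alternating sum of the faces of \<sigma>
      with factor \<open>w \<sigma>\<close>: on the right, rescaling each face by its own weight
      cancels the denominator. In degree 0 both sides vanish.\<close>
    have "linear_extension (simplex_boundary (\<lambda>_. 1) k) (Poly_Mapping.single \<sigma> (w \<sigma>)) =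
        ?scale w (simplex_boundary w k \<sigma>)" if \<sigma>: "\<sigma> \<in> simplices K k" for \<sigma>
    proof (cases k)
      case (Suc m)
      have "w (face i \<sigma>) \<noteq> 0" if "i \<le> k" for i
        using face_in_simplices[OF K] \<sigma> that w unfolding Suc by blast
      then show ?thesis
        unfolding linear_extension_single simplex_boundary_def using Suc
        by (auto simp: map_mult_sum map_mult_single linear_extension_sum linear_extension_single
            simp del: sum.atMost_Suc intro!: sum.cong)
    qed (simp add: linear_extension_single simplex_boundary_def map_mult_zero)
    then show "simplicial_boundary k (?scale w c) = ?scale w (weighted_boundary w k c)"
      using c unfolding simplicial_boundary_eq weighted_boundary_eq linear_extension_linear_extension
      by (intro linear_extension_cong) blast
  qed
qed

end
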